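(* Let $(X,\mathfrak A,\mu)$ be a $\sigma$-finite measure space and let $q$ be a closed quadratic form on $L^2(X,\mu)$ satisfying the first Beurling-Deny criterion with $\ker q=\{0\}$. For every strictly positive $h\in L^2(X,\mu)$ and every nonnegative $w\in L^2(X,\mu)\cap L^1(X,h^2\mu)$ there exists a decreasing function $\alpha=\alpha_{w,h}\colon(0,\infty)\to(0,\infty)$ such that for all $r>0$ and all $f\in D(q)$ $$\int_X|f|^2w\,d\mu\le\alpha(r)\,q(f)+r\,\|f/h\|_\infty^2 .$$
   Context: All functions are real-valued. A quadratic form $q\colon L^2(X,\mu)\to[0,\infty]$ satisfies $q(\lambda f)=\lambda^2q(f)$ for $\lambda\in\mathbb R$ ($0\cdot\infty=0$) and the parallelogram identity. Its domain is $D(q)=\{f\mid q(f)<\infty\}$, its kernel is $\ker q=\{f\mid q(f)=0\}$. It is closed if $D(q)$ is complete with respect to the metric $q(f-g)^{1/2}+\|f-g\|_2$ (equivalently, $q$ is lower semicontinuous on $L^2(X,\mu)$). Standing assumption: $D(q)$ is dense in $L^2(X,\mu)$. $q$ satisfies the first Beurling-Deny criterion if $q(|f|)\le q(f)$ for all $f\in L^2(X,\mu)$. Strictly positive means $>0$ $\mu$-a.e. $\|f/h\|_\infty\in[0,\infty]$ is the essential supremum of $|f/h|$. Decreasing means nonincreasing. *)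

theory Defs
  imports "HOL-Probability.Essential_Supremum"
begin

text \<open>
  Elements of \<open>L\<^sup>2\<close> are represented by square-integrable functions rather than by
  a.e.-equivalence classes. Accordingly a form is a map on functions that is required to
  respect a.e. equality; its values outside \<open>L2 M\<close> are irrelevant.
\<close>

definition L2 :: "'a measure \<Rightarrow> ('a \<Rightarrow> real) set" where
  "L2 M = {f \<in> borel_measurable M. integrable M (\<lambda>x. (f x)\<^sup>2)}"

definition L2_norm :: "'a measure \<Rightarrow> ('a \<Rightarrow> real) \<Rightarrow> real" where
  "L2_norm M f = sqrt (\<integral>x. (f x)\<^sup>2 \<partial>M)"

text \<open>In \<^typ>\<open>ennreal\<close> we have \<open>0 * \<infinity> = 0\<close>, as the homogeneity condition requires.\<close>

definition quadratic_form :: "'a measure \<Rightarrow> (('a \<Rightarrow> real) \<Rightarrow> ennreal) \<Rightarrow> bool" where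
  "quadratic_form M q \<longleftrightarrow>
     (\<forall>f\<in>L2 M. \<forall>g\<in>L2 M. (AE x in M. f x = g x) \<longrightarrow> q f = q g) \<and>
     (\<forall>f\<in>L2 M. \<forall>c::real. q (\<lambda>x. c * f x) = ennreal (c\<^sup>2) * q f) \<and>
     (\<forall>f\<in>L2 M. \<forall>g\<in>L2 M.
        q (\<lambda>x. f x + g x) + q (\<lambda>x. f x - g x) = 2 * q f + 2 * q g)"

definition form_domain :: "'a measure \<Rightarrow> (('a \<Rightarrow> real) \<Rightarrow> ennreal) \<Rightarrow> ('a \<Rightarrow> real) set" where
  "form_domain M q = {f \<in> L2 M. q f < \<infinity>}"

definition form_kernel :: "'a measure \<Rightarrow> (('a \<Rightarrow> real) \<Rightarrow> ennreal) \<Rightarrow> ('a \<Rightarrow> real) set" where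
  "form_kernel M q = {f \<in> L2 M. q f = 0}"

definition densely_defined :: "'a measure \<Rightarrow> (('a \<Rightarrow> real) \<Rightarrow> ennreal) \<Rightarrow> bool" where
  "densely_defined M q \<longleftrightarrow>
     (\<forall>f\<in>L2 M. \<forall>\<epsilon>>0. \<exists>g\<in>form_domain M q. L2_norm M (\<lambda>x. f x - g x) < \<epsilon>)"

text \<open>
  Used only for \<open>f, g\<close> in \<^const>\<open>form_domain\<close>, where \<open>q (f - g)\<close> is finite by the
  parallelogram identity, so that \<^const>\<open>enn2real\<close> loses nothing.
\<close>

definition form_dist ::
    "'a measure \<Rightarrow> (('a \<Rightarrow> real) \<Rightarrow> ennreal) \<Rightarrow> ('a \<Rightarrow> real) \<Rightarrow> ('a \<Rightarrow> real) \<Rightarrow> real" where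
  "form_dist M q f g =
     sqrt (enn2real (q (\<lambda>x. f x - g x))) + L2_norm M (\<lambda>x. f x - g x)"

definition closed_form :: "'a measure \<Rightarrow> (('a \<Rightarrow> real) \<Rightarrow> ennreal) \<Rightarrow> bool" where
  "closed_form M q \<longleftrightarrow>
     (\<forall>u::nat \<Rightarrow> 'a \<Rightarrow> real.
        range u \<subseteq> form_domain M q \<and>
        (\<forall>\<epsilon>>0. \<exists>N. \<forall>m\<ge>N. \<forall>n\<ge>N. form_dist M q (u m) (u n) < \<epsilon>) \<longrightarrow>
        (\<exists>f\<in>form_domain M q. (\<lambda>n. form_dist M q (u n) f) \<longlonglongrightarrow> 0))"

definition first_Beurling_Deny :: "'a measure \<Rightarrow> (('a \<Rightarrow> real) \<Rightarrow> ennreal) \<Rightarrow> bool" where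
  "first_Beurling_Deny M q \<longleftrightarrow> (\<forall>f\<in>L2 M. q (\<lambda>x. \<bar>f x\<bar>) \<le> q f)"

text \<open>
  The essential supremum is taken in \<^typ>\<open>ennreal\<close>, hence is \<open>\<infinity>\<close> for essentially
  unbounded functions and \<open>0\<close> (not \<open>-\<infinity>\<close>) if the measure is zero.
\<close>

definition Linf_norm :: "'a measure \<Rightarrow> ('a \<Rightarrow> real) \<Rightarrow> ennreal" where
  "Linf_norm M f = esssup M (\<lambda>x. ennreal \<bar>f x\<bar>)"

end

theory Submission
  imports Defs
begin

text \<open>
  Under the constraint \<open>\<bar>f\<bar> \<le> h\<close> the left-hand side is at most \<open>\<integral>h\<^sup>2w < \<infinity>\<close>, so only small
  \<open>q f\<close> matters. If \<open>q f\<close> is small, then \<open>q \<bar>f\<bar>\<close> is small too, and closedness with trivial kernel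
  forces \<open>\<bar>f\<bar>\<close> to be weakly close to \<open>0\<close>; testing against \<open>h\<close> and truncating \<open>w\<close> at a
  height \<open>K\<close> gives \<open>\<integral>f\<^sup>2w \<le> K \<integral>\<bar>f\<bar>h + \<integral>\<^bsub>w > K\<^esub> h\<^sup>2w \<le> r\<close>. Weak compactness is avoided: elements
  of almost minimal norm in the convex sets \<open>{f. q f \<le> 1/n, \<integral>fg \<ge> \<delta>}\<close> form a Cauchy sequence.
\<close>

section \<open>Square-integrable functions: vector space structure and a Cauchy-Schwarz
  bound\<close>

lemma L2_borel [measurable_dest]: "f \<in> L2 M \<Longrightarrow> f \<in> borel_measurable M"
  and L2_integrable_square: "f \<in> L2 M \<Longrightarrow> integrable M (\<lambda>x. (f x)\<^sup>2)"
  by (auto simp: L2_def)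

lemma L2_integrable_mult:
  assumes "f \<in> L2 M" "g \<in> L2 M"
  shows "integrable M (\<lambda>x. f x * g x)"
proof (rule Bochner_Integration.integrable_bound)
  show "integrable M (\<lambda>x. (f x)\<^sup>2 + (g x)\<^sup>2)"
    using assms by (auto intro: L2_integrable_square)
  show "(\<lambda>x. f x * g x) \<in> borel_measurable M"
    using assms by measurable
  have "\<bar>a * b\<bar> \<le> a\<^sup>2 + b\<^sup>2" for a b :: real
  proof -
    have "2 * (\<bar>a\<bar> * \<bar>b\<bar>) \<le> a\<^sup>2 + b\<^sup>2"
      using sum_squares_bound[of "\<bar>a\<bar>" "\<bar>b\<bar>"] by simp
    moreover have "0 \<le> \<bar>a\<bar> * \<bar>b\<bar>" by simp
    ultimately show ?thesis unfolding abs_mult by linarith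
  qed
  then show "AE x in M. norm (f x * g x) \<le> norm ((f x)\<^sup>2 + (g x)\<^sup>2)"
    by simp
qed

lemma L2_add: "f \<in> L2 M \<Longrightarrow> g \<in> L2 M \<Longrightarrow> (\<lambda>x. f x + g x) \<in> L2 M"
  using L2_integrable_mult[of f M g]
  by (auto simp: L2_def power2_sum mult.assoc)

lemma L2_cmult: "f \<in> L2 M \<Longrightarrow> (\<lambda>x. c * f x) \<in> L2 M"
  by (auto simp: L2_def power_mult_distrib)

lemma L2_diff: "f \<in> L2 M \<Longrightarrow> g \<in> L2 M \<Longrightarrow> (\<lambda>x. f x - g x) \<in> L2 M"
  using L2_add[of f M "\<lambda>x. -1 * g x"] L2_cmult[of g M "-1"] by simp

lemma L2_abs: "f \<in> L2 M \<Longrightarrow> (\<lambda>x. \<bar>f x\<bar>) \<in> L2 M"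
  by (auto simp: L2_def)

lemma L2_integral_square_add:
  assumes "f \<in> L2 M" "g \<in> L2 M"
  shows "(\<integral>x. (f x + g x)\<^sup>2 \<partial>M) = (\<integral>x. (f x)\<^sup>2 \<partial>M) + (\<integral>x. (g x)\<^sup>2 \<partial>M) + 2 * (\<integral>x. f x * g x \<partial>M)"
  using assms L2_integrable_mult[OF assms] by (simp add: power2_sum L2_integrable_square mult.assoc)

lemma L2_integral_square_diff:
  assumes "f \<in> L2 M" "g \<in> L2 M"
  shows "(\<integral>x. (f x - g x)\<^sup>2 \<partial>M) = (\<integral>x. (f x)\<^sup>2 \<partial>M) + (\<integral>x. (g x)\<^sup>2 \<partial>M) - 2 * (\<integral>x. f x * g x \<partial>M)"
  using assms L2_integrable_mult[OF assms] by (simp add: power2_diff L2_integrable_square mult.assoc)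

text \<open>The summand \<open>1\<close> avoids a case distinction on \<open>\<integral>g\<^sup>2 = 0\<close>.\<close>

lemma L2_Cauchy_Schwarz_plus_one:
  assumes "f \<in> L2 M" "g \<in> L2 M"
  shows "(\<integral>x. f x * g x \<partial>M)\<^sup>2 \<le> (\<integral>x. (f x)\<^sup>2 \<partial>M) * ((\<integral>x. (g x)\<^sup>2 \<partial>M) + 1)"
proof -
  \<comment> \<open>This \<open>s\<close> minimises \<open>s\<^sup>2 * (G + 1) - 2 * s * I\<close>.
    Its minimum is \<open>- I\<^sup>2 / (G + 1)\<close>, and the true expansion differs from it by
    the harmless term \<open>- s\<^sup>2\<close>.\<close>
  define F G I s where "F = (\<integral>x. (f x)\<^sup>2 \<partial>M)" and "G = (\<integral>x. (g x)\<^sup>2 \<partial>M)"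
    and "I = (\<integral>x. f x * g x \<partial>M)" and "s = I / (G + 1)"
  have "0 \<le> G" by (simp add: G_def)
  have "0 \<le> (\<integral>x. (f x - s * g x)\<^sup>2 \<partial>M)" by simp
  also have "\<dots> = F + s\<^sup>2 * G - 2 * s * I"
    using L2_integral_square_diff[OF assms(1) L2_cmult[OF assms(2)], of s]
    by (simp add: F_def G_def I_def power_mult_distrib mult.left_commute[of _ s])
  also have "\<dots> = F - I\<^sup>2 / (G + 1) - s\<^sup>2"
  proof -
    have I: "I = s * (G + 1)" using \<open>0 \<le> G\<close> by (simp add: s_def)
    then have "I\<^sup>2 / (G + 1) = s * I" using \<open>0 \<le> G\<close> by (simp add: power2_eq_square)
    then show ?thesis by (simp add: I power2_eq_square algebra_simps)
  qed
  finally have "I\<^sup>2 / (G + 1) \<le> F" using zero_le_power2[of s] by linarith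
  then show ?thesis using \<open>0 \<le> G\<close> by (simp add: pos_divide_le_eq flip: F_def G_def I_def)
qed

section \<open>Quadratic forms: parallelogram estimates and the weak smallness they yield\<close>

lemma four_ennreal: "0 \<le> e \<Longrightarrow> 2 * ennreal e + 2 * ennreal e = ennreal (4 * e)"
  unfolding distrib_right[symmetric] by (simp add: ennreal_mult)

context
  fixes M :: "'a measure" and q :: "('a \<Rightarrow> real) \<Rightarrow> ennreal"
  assumes q: "quadratic_form M q"
begin

lemma form_cmult: "f \<in> L2 M \<Longrightarrow> q (\<lambda>x. c * f x) = ennreal (c\<^sup>2) * q f"
  by (rule q[unfolded quadratic_form_def, THEN conjunct2, THEN conjunct1, rule_format])

lemma form_parallelogram:
  "f \<in> L2 M \<Longrightarrow> g \<in> L2 M \<Longrightarrow> q (\<lambda>x. f x + g x) + q (\<lambda>x. f x - g x) = 2 * q f + 2 * q g"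
  by (rule q[unfolded quadratic_form_def, THEN conjunct2, THEN conjunct2, rule_format])

lemma form_add_le: "f \<in> L2 M \<Longrightarrow> g \<in> L2 M \<Longrightarrow> q (\<lambda>x. f x + g x) \<le> 2 * q f + 2 * q g"
  by (subst form_parallelogram[symmetric]) simp_all

lemma form_diff_le: "f \<in> L2 M \<Longrightarrow> g \<in> L2 M \<Longrightarrow> q (\<lambda>x. f x - g x) \<le> 2 * q f + 2 * q g"
  by (subst form_parallelogram[symmetric]) simp_all

text \<open>Sublevel sets of \<open>q\<close> are midpoint convex: homogeneity turns the factor
  \<open>1/2\<close> into \<open>1/4\<close>, which cancels the 4 from the parallelogram bound. This
  is the convexity that the norm minimisation below relies on.\<close>

lemma form_midpoint_le:
  assumes "f \<in> L2 M" "g \<in> L2 M" "0 \<le> e" "q f \<le> ennreal e" "q g \<le> ennreal e"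
  shows "q (\<lambda>x. 1/2 * (f x + g x)) \<le> ennreal e"
proof -
  have "q (\<lambda>x. 1/2 * (f x + g x)) = ennreal (1/4) * q (\<lambda>x. f x + g x)"
    using form_cmult[OF L2_add[OF assms(1,2)], of "1/2"] by (simp add: power2_eq_square)
  also have "\<dots> \<le> ennreal (1/4) * (2 * ennreal e + 2 * ennreal e)"
    by (intro mult_left_mono order_trans[OF form_add_le[OF assms(1,2)]] add_mono assms(4,5)) simp_all
  also have "\<dots> = ennreal (1/4 * (4 * e))"
    unfolding four_ennreal[OF assms(3)] using assms(3) by (intro ennreal_mult[symmetric]) simp_all
  finally show ?thesis by simp
qed

text \<open>One \<epsilon> serves a whole ball of L2. Otherwise near-minimisers \<open>u n\<close>
  exist that converge in the form metric to some \<open>f\<close> with \<open>q f = 0\<close>. Hence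
  \<open>f\<close> vanishes a.e. and the norms of \<open>u n\<close> tend to 0, against the
  integrals with \<open>g\<close> staying above \<delta>.\<close>

lemma integral_lt_of_form_small:
  assumes closed: "closed_form M q"
    and kernel: "\<And>f. f \<in> L2 M \<Longrightarrow> q f = 0 \<Longrightarrow> AE x in M. f x = 0"
    and g: "g \<in> L2 M" and "0 < \<delta>"
  shows "\<exists>\<epsilon>>0. \<forall>f\<in>L2 M. q f \<le> ennreal \<epsilon> \<longrightarrow> (\<integral>x. (f x)\<^sup>2 \<partial>M) \<le> B \<longrightarrow> (\<integral>x. f x * g x \<partial>M) < \<delta>"
proof (rule ccontr)
  assume neg: "\<not> ?thesis"
  define e :: "nat \<Rightarrow> real" where "e n = 1 / Suc n" for n
  have e_pos: "0 < e n" for n by (simp add: e_def)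
  have e_anti: "e m \<le> e n" if "n \<le> m" for m n using that by (simp add: e_def frac_le)
  have e_lim: "e \<longlonglongrightarrow> 0" unfolding e_def by (rule LIMSEQ_Suc[OF lim_1_over_n])
  define N where "N f = (\<integral>x. (f x)\<^sup>2 \<partial>M)" for f :: "'a \<Rightarrow> real"
  have N_nonneg [simp]: "0 \<le> N f" for f by (simp add: N_def)
  \<comment> \<open>The constraint on the integral is one-sided, so it cuts out a half-space and
    \<open>S n\<close> is convex; a bound on the absolute value from below would not be. The radius
    \<open>B\<close> enters only through the bound on the infima \<open>d n\<close>.\<close>
  define S where "S n = {f \<in> L2 M. q f \<le> ennreal (e n) \<and> \<delta> \<le> (\<integral>x. f x * g x \<partial>M)}" for n
  have S_L2: "f \<in> L2 M" if "f \<in> S n" for f n using that by (simp add: S_def)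
  have S_anti: "S m \<subseteq> S n" if "n \<le> m" for m n
    using ennreal_leI[OF e_anti[OF that]] by (auto simp: S_def)
  have S_bounded: "\<exists>f\<in>S n. N f \<le> B" for n
  proof -
    obtain f where "f \<in> L2 M" "q f \<le> ennreal (e n)" "N f \<le> B" "\<delta> \<le> (\<integral>x. f x * g x \<partial>M)"
      using neg e_pos[of n] unfolding N_def by (meson not_le)
    then show ?thesis by (auto simp: S_def)
  qed
  define d where "d n = Inf (N ` S n)" for n
  have bdd: "bdd_below (N ` S n)" for n by (rule bdd_belowI[of _ 0]) auto
  have d_le: "d n \<le> N f" if "f \<in> S n" for f n
    unfolding d_def using that bdd by (intro cInf_lower) auto
  have d_mono: "incseq d"
    unfolding d_def
    by (intro incseq_SucI cInf_superset_mono image_mono S_anti bdd) (use S_bounded in auto)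
  \<comment> \<open>The infima increase along shrinking sets and stay in \<open>[0, B]\<close>.
    Their gaps \<open>d m - d n\<close> will control the distances between near-minimisers.\<close>
  have "convergent d"
  proof (rule Bseq_monoseq_convergent)
    show "monoseq d" using d_mono by (simp add: monoseq_iff)
    have "norm (d n) \<le> B" for n
    proof -
      obtain f where f: "f \<in> S n" "N f \<le> B" using S_bounded by blast
      have "0 \<le> d n" unfolding d_def by (rule cInf_greatest) (use f in auto)
      then show ?thesis using d_le[OF f(1)] f(2) by simp
    qed
    then show "Bseq d" by (rule BseqI')
  qed
  then have "Cauchy d" by (rule convergent_Cauchy)
  have "\<exists>f\<in>S n. N f < d n + e n" for n
    using S_bounded[of n] e_pos[of n] bdd cInf_lessD[of "N ` S n" "d n + e n"] by (auto simp: d_def)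
  then obtain u where u: "u n \<in> S n" and Nu: "N (u n) < d n + e n" for n by metis
  have uL2: "u n \<in> L2 M" for n using u S_L2 by blast
  have qu: "q (u n) \<le> ennreal (e n)" for n using u by (simp add: S_def)
  have u_dom: "u n \<in> form_domain M q" for n
    using uL2 le_less_trans[OF qu ennreal_less_top] by (simp add: form_domain_def)
  have mid: "(\<lambda>x. 1/2 * (f x + k x)) \<in> S n" if "f \<in> S n" "k \<in> S n" for f k n
  proof -
    have L: "f \<in> L2 M" "k \<in> L2 M" using that S_L2 by auto
    have "(\<integral>x. 1/2 * (f x + k x) * g x \<partial>M) = 1/2 * ((\<integral>x. f x * g x \<partial>M) + (\<integral>x. k x * g x \<partial>M))"
      using L2_integrable_mult[OF _ g] L by (simp add: distrib_right)
    then show ?thesis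
      using that L L2_cmult[OF L2_add[OF L], of "1/2"] form_midpoint_le[OF L, of "e n"] e_pos[of n]
      by (auto simp: S_def)
  qed
  \<comment> \<open>The midpoint of \<open>u n\<close> and \<open>u m\<close> lies in the larger set
    \<open>S n\<close>, so its squared norm is at least \<open>d n\<close>; the parallelogram law in
    L2 then bounds the difference. The slacks \<open>2 * e n\<close> and \<open>2 * e m\<close> are
    merged into \<open>4 * e n\<close>.\<close>
  have N_diff: "N (\<lambda>x. u n x - u m x) \<le> 2 * (d m - d n) + 4 * e n" if "n \<le> m" for n m
  proof -
    have "d n \<le> N (\<lambda>x. 1/2 * (u n x + u m x))"
      using d_le mid u S_anti[OF that] by blast
    also have "\<dots> = 1/4 * N (\<lambda>x. u n x + u m x)"
      unfolding N_def power_mult_distrib by (simp add: power2_eq_square)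
    finally have "N (\<lambda>x. u n x - u m x) \<le> 2 * N (u n) + 2 * N (u m) - 4 * d n"
      using L2_integral_square_add[OF uL2 uL2, of n m] L2_integral_square_diff[OF uL2 uL2, of n m]
      by (simp add: N_def)
    with Nu[of n] Nu[of m] e_anti[OF that] show ?thesis by (smt (verit) distrib_left)
  qed
  have q_diff: "enn2real (q (\<lambda>x. u n x - u m x)) \<le> 4 * e n" if "n \<le> m" for n m
  proof -
    have "q (\<lambda>x. u n x - u m x) \<le> 2 * ennreal (e n) + 2 * ennreal (e n)"
      using qu[of n] order_trans[OF qu[of m] ennreal_leI[OF e_anti[OF that]]]
      by (intro order_trans[OF form_diff_le[OF uL2 uL2]] add_mono mult_left_mono) simp_all
    also have "\<dots> = ennreal (4 * e n)"
      using e_pos[of n] by (intro four_ennreal) simp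
    finally show ?thesis using e_pos[of n] by (simp add: enn2real_leI)
  qed
  \<comment> \<open>The two estimates above assume \<open>n \<le> m\<close>; symmetry covers the
    other order.\<close>
  have form_dist_sym: "form_dist M q (u m) (u n) = form_dist M q (u n) (u m)" for m n
    using form_cmult[OF L2_diff[OF uL2 uL2], of "-1" m n]
    by (simp add: form_dist_def L2_norm_def power2_commute)
  have "\<exists>K. \<forall>m\<ge>K. \<forall>n\<ge>K. form_dist M q (u m) (u n) < \<epsilon>" if "0 < \<epsilon>" for \<epsilon>
  proof -
    \<comment> \<open>With the gap of \<open>d\<close> and \<open>e n\<close> both below
      \<open>c\<close>, the bounds are at most \<open>4 * c\<close> for the form and
      \<open>2 * c + 4 * c\<close> for the norm. Both lie below \<open>8 * c\<close>, so each square
      root is below \<epsilon>/2.\<close>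
    define c where "c = (\<epsilon>/2)\<^sup>2 / 8"
    have "0 < c" and c8: "(\<epsilon>/2)\<^sup>2 = 8 * c" using that by (simp_all add: c_def)
    obtain K1 where K1: "\<And>m n. m \<ge> K1 \<Longrightarrow> n \<ge> K1 \<Longrightarrow> \<bar>d m - d n\<bar> < c"
      using \<open>Cauchy d\<close> \<open>0 < c\<close> unfolding Cauchy_def dist_real_def by meson
    obtain K2 where K2: "\<And>n. n \<ge> K2 \<Longrightarrow> e n < c"
      using order_tendstoD(2)[OF e_lim \<open>0 < c\<close>] by (auto simp: eventually_sequentially)
    have less: "form_dist M q (u n) (u m) < \<epsilon>" if "n \<le> m" "max K1 K2 \<le> n" for m n
    proof -
      have "enn2real (q (\<lambda>x. u n x - u m x)) < (\<epsilon>/2)\<^sup>2"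
        using q_diff[OF that(1)] K2[of n] that \<open>0 < c\<close> c8 by linarith
      moreover have "N (\<lambda>x. u n x - u m x) < (\<epsilon>/2)\<^sup>2"
        using N_diff[OF that(1)] K2[of n] K1[of m n] that \<open>0 < c\<close> c8 by (smt (verit) max.bounded_iff order_trans)
      ultimately have "sqrt (enn2real (q (\<lambda>x. u n x - u m x))) < \<epsilon>/2"
        "sqrt (N (\<lambda>x. u n x - u m x)) < \<epsilon>/2"
        using \<open>0 < \<epsilon>\<close> by (intro real_less_lsqrt; simp)+
      then show ?thesis unfolding form_dist_def L2_norm_def N_def by linarith
    qed
    have "form_dist M q (u m) (u n) < \<epsilon>" if "max K1 K2 \<le> m" "max K1 K2 \<le> n" for m n
      using less[of m n] less[of n m] form_dist_sym[of m n] that by (cases "m \<le> n") auto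
    then show ?thesis by blast
  qed
  then obtain f where f: "f \<in> form_domain M q" and lim: "(\<lambda>n. form_dist M q (u n) f) \<longlonglongrightarrow> 0"
    using closed u_dom unfolding closed_form_def by (metis image_subset_iff)
  have fL2: "f \<in> L2 M" using f by (simp add: form_domain_def)
  have lim_q: "(\<lambda>n. sqrt (enn2real (q (\<lambda>x. u n x - f x)))) \<longlonglongrightarrow> 0"
    by (rule tendsto_sandwich[OF _ _ tendsto_const lim])
      (auto simp: form_dist_def L2_norm_def)
  have lim_N: "(\<lambda>n. sqrt (N (\<lambda>x. u n x - f x))) \<longlonglongrightarrow> 0"
    by (rule tendsto_sandwich[OF _ _ tendsto_const lim])
      (auto simp: form_dist_def L2_norm_def N_def)
  \<comment> \<open>Finiteness matters because \<open>enn2real\<close> sends \<infinity> to 0: only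
    for finite values does a small \<open>form_dist\<close> mean a small \<open>q\<close>.\<close>
  have diff_fin: "q (\<lambda>x. u n x - f x) < \<infinity>" for n
    using u_dom[of n] f
    by (intro le_less_trans[OF form_diff_le[OF uL2 fL2]])
      (simp add: form_domain_def ennreal_mult_less_top)
  \<comment> \<open>Writing \<open>f\<close> as \<open>u n - (u n - f)\<close> takes the place of
    lower semicontinuity of \<open>q\<close>.\<close>
  have q_f: "q f \<le> ennreal (2 * e n + 2 * (sqrt (enn2real (q (\<lambda>x. u n x - f x))))\<^sup>2)" for n
  proof -
    have "q f \<le> 2 * q (u n) + 2 * q (\<lambda>x. u n x - f x)"
      using form_diff_le[OF uL2 L2_diff[OF uL2 fL2], of n n] by simp
    also have "\<dots> \<le> 2 * ennreal (e n) + 2 * ennreal (enn2real (q (\<lambda>x. u n x - f x)))"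
      using qu[of n] diff_fin[of n] by (intro add_mono mult_left_mono) auto
    also have "\<dots> = ennreal (2 * e n + 2 * enn2real (q (\<lambda>x. u n x - f x)))"
      using less_imp_le[OF e_pos[of n]] by (simp add: ennreal_mult)
    finally show ?thesis by simp
  qed
  have "(\<lambda>n. ennreal (2 * e n + 2 * (sqrt (enn2real (q (\<lambda>x. u n x - f x))))\<^sup>2)) \<longlonglongrightarrow> ennreal (2 * 0 + 2 * 0\<^sup>2)"
    by (intro tendsto_intros e_lim lim_q)
  then have "q f \<le> ennreal (2 * 0 + 2 * 0\<^sup>2)" by (rule LIMSEQ_le_const) (use q_f in blast)
  then have "AE x in M. f x = 0" using kernel[OF fL2] by simp
  then have "N (\<lambda>x. u n x - f x) = N (u n)" for n
    unfolding N_def using uL2 fL2 by (intro integral_cong_AE) (measurable, auto)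
  then have "(\<lambda>n. (sqrt (N (u n)))\<^sup>2 * (N g + 1)) \<longlonglongrightarrow> 0\<^sup>2 * (N g + 1)"
    using lim_N by (intro tendsto_intros) simp
  moreover have "\<delta>\<^sup>2 \<le> (sqrt (N (u n)))\<^sup>2 * (N g + 1)" for n
  proof -
    have "\<delta>\<^sup>2 \<le> (\<integral>x. u n x * g x \<partial>M)\<^sup>2"
      using u[of n] \<open>0 < \<delta>\<close> by (intro power_mono) (auto simp: S_def)
    also have "\<dots> \<le> N (u n) * (N g + 1)"
      using L2_Cauchy_Schwarz_plus_one[OF uL2 g] by (simp add: N_def)
    finally show ?thesis by simp
  qed
  ultimately have "\<delta>\<^sup>2 \<le> 0\<^sup>2 * (N g + 1)" by (intro LIMSEQ_le_const) auto
  then show False using \<open>0 < \<delta>\<close> by simp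
qed

end

section \<open>The weighted inequality: truncation of the weight, the constrained case, and
  scaling\<close>

lemma integral_tail_small:
  fixes k w :: "'a \<Rightarrow> real"
  assumes "integrable M k" "w \<in> borel_measurable M" "0 < r"
  shows "\<exists>K>0. (\<integral>x. (if K < w x then k x else 0) \<partial>M) < r"
proof -
  \<comment> \<open>Since \<open>w x\<close> is a real number, the integrand vanishes at each point
    for large \<open>n\<close>, and the absolute value of \<open>k\<close> dominates.\<close>
  have "(\<lambda>n. \<integral>x. (if real n < w x then k x else 0) \<partial>M) \<longlonglongrightarrow> (\<integral>x. 0 \<partial>M)"
  proof (rule integral_dominated_convergence)
    show "integrable M (\<lambda>x. \<bar>k x\<bar>)" using assms by simp
    have "(\<lambda>n. if real n < w x then k x else 0) \<longlonglongrightarrow> 0" for x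
    proof (rule tendsto_eventually)
      obtain n0 where "w x \<le> real n0" using real_arch_simple by blast
      then have "\<forall>n\<ge>n0. \<not> real n < w x" by (meson not_le of_nat_le_iff order_trans)
      then show "\<forall>\<^sub>F n in sequentially. (if real n < w x then k x else 0) = 0"
        unfolding eventually_sequentially by (intro exI[of _ n0]) simp
    qed
    then show "AE x in M. (\<lambda>n. if real n < w x then k x else 0) \<longlonglongrightarrow> 0" by simp
  qed (use assms in \<open>auto dest: borel_measurable_integrable\<close>)
  then have "\<forall>\<^sub>F n in sequentially. (\<integral>x. (if real n < w x then k x else 0) \<partial>M) < r"
    using \<open>0 < r\<close> by (intro order_tendstoD(2)[of _ 0]) simp_all
  then have "\<forall>\<^sub>F n in sequentially. 0 < n \<and> (\<integral>x. (if real n < w x then k x else 0) \<partial>M) < r"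
    by (intro eventually_conj eventually_gt_at_top)
  then obtain n where "0 < n" "(\<integral>x. (if real n < w x then k x else 0) \<partial>M) < r"
    by (auto simp: eventually_sequentially)
  then show ?thesis by (intro exI[of _ "real n"]) simp
qed

text \<open>This is the normalised case, in which the essential supremum of the quotient of
  \<open>f\<close> by \<open>h\<close> is at most 1.\<close>

lemma weak_Hardy_dominated:
  fixes M :: "'a measure" and q :: "('a \<Rightarrow> real) \<Rightarrow> ennreal" and h w :: "'a \<Rightarrow> real"
  assumes q: "quadratic_form M q" and closed: "closed_form M q"
    and BD: "first_Beurling_Deny M q"
    and kernel: "\<And>f. f \<in> L2 M \<Longrightarrow> q f = 0 \<Longrightarrow> AE x in M. f x = 0"
    and h: "h \<in> L2 M" and w: "w \<in> borel_measurable M" and w0: "AE x in M. 0 \<le> w x"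
    and hw: "integrable M (\<lambda>x. (h x)\<^sup>2 * w x)"
    and r: "0 < r"
  shows "\<exists>a\<ge>0. \<forall>f\<in>L2 M. (AE x in M. \<bar>f x\<bar> \<le> h x) \<longrightarrow>
    (\<integral>\<^sup>+x. ennreal ((f x)\<^sup>2 * w x) \<partial>M) \<le> ennreal a * q f + ennreal r"
proof -
  define C where "C = (\<integral>x. (h x)\<^sup>2 * w x \<partial>M)"
  have C0: "0 \<le> C" unfolding C_def using w0 by (intro integral_nonneg_AE) auto
  \<comment> \<open>Half of \<open>r\<close> pays for the region where \<open>w\<close> exceeds
    \<open>K\<close>. On the rest \<open>w\<close> costs a factor \<open>K\<close>, so the threshold
    \<open>r / (2 * K)\<close> below yields the other half.\<close>
  obtain K where K: "0 < K" and tail: "(\<integral>x. (if K < w x then (h x)\<^sup>2 * w x else 0) \<partial>M) < r/2"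
    using integral_tail_small[OF hw w, of "r/2"] r by auto
  obtain \<epsilon> where \<epsilon>: "0 < \<epsilon>" and small: "\<And>f. f \<in> L2 M \<Longrightarrow> q f \<le> ennreal \<epsilon> \<Longrightarrow>
      (\<integral>x. (f x)\<^sup>2 \<partial>M) \<le> (\<integral>x. (h x)\<^sup>2 \<partial>M) \<Longrightarrow> (\<integral>x. f x * h x \<partial>M) < r / (2 * K)"
  proof -
    have "0 < r / (2 * K)" using r K by simp
    from integral_lt_of_form_small[OF q closed kernel h this] that show ?thesis by blast
  qed
  \<comment> \<open>If \<open>q f\<close> exceeds \<epsilon>, the form term alone dominates
    \<open>C\<close>, even when \<open>q f\<close> is infinite. Otherwise the term \<open>r\<close>
    alone suffices.\<close>
  have "(\<integral>\<^sup>+x. ennreal ((f x)\<^sup>2 * w x) \<partial>M) \<le> ennreal (C / \<epsilon>) * q f + ennreal r"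
    if f: "f \<in> L2 M" and fh: "AE x in M. \<bar>f x\<bar> \<le> h x" for f
  proof (cases "q f \<le> ennreal \<epsilon>")
    case True
    have sq: "(f x)\<^sup>2 \<le> (h x)\<^sup>2" if "\<bar>f x\<bar> \<le> h x" for x
      using that by (metis abs_ge_zero power2_abs power_mono)
    \<comment> \<open>\<open>small\<close> controls a signed integral, where cancellation could hide
      a large \<open>f\<close>. The Beurling-Deny criterion allows applying it to the absolute value
      of \<open>f\<close>.\<close>
    have bound: "(\<integral>x. \<bar>f x\<bar> * h x \<partial>M) < r / (2 * K)"
    proof (rule small[OF L2_abs[OF f]])
      show "q (\<lambda>x. \<bar>f x\<bar>) \<le> ennreal \<epsilon>"
        using BD f True by (auto simp: first_Beurling_Deny_def intro: order_trans)
      show "(\<integral>x. \<bar>f x\<bar>\<^sup>2 \<partial>M) \<le> (\<integral>x. (h x)\<^sup>2 \<partial>M)"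
        using f h fh sq by (intro integral_mono_AE) (auto intro: L2_integrable_square)
    qed
    have [measurable]: "f \<in> borel_measurable M" "h \<in> borel_measurable M" "w \<in> borel_measurable M"
      using f h w by (auto dest: L2_borel)
    define G where "G x = K * (\<bar>f x\<bar> * h x) + (if K < w x then (h x)\<^sup>2 * w x else 0)" for x
    have int_tail: "integrable M (\<lambda>x. if K < w x then (h x)\<^sup>2 * w x else 0)"
      by (rule Bochner_Integration.integrable_bound[OF hw]) simp_all
    have G: "integrable M G"
      unfolding G_def using int_tail L2_integrable_mult[OF L2_abs[OF f] h] by simp
    have le: "(f x)\<^sup>2 * w x \<le> G x \<and> 0 \<le> G x" if "0 \<le> w x" "\<bar>f x\<bar> \<le> h x" for x
    proof -
      have "0 \<le> h x" using that by linarith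
      have "(f x)\<^sup>2 * w x \<le> G x"
      proof (cases "K < w x")
        case True
        then show ?thesis
          using mult_right_mono[OF sq[OF that(2)] that(1)] K \<open>0 \<le> h x\<close> by (simp add: G_def add_increasing)
      next
        case False
        have "\<bar>f x\<bar> * \<bar>f x\<bar> * w x \<le> \<bar>f x\<bar> * h x * K"
          using False that \<open>0 \<le> h x\<close> by (intro mult_mono) auto
        then show ?thesis using False by (simp add: G_def power2_eq_square mult_ac)
      qed
      moreover have "0 \<le> (f x)\<^sup>2 * w x" using that by simp
      ultimately show ?thesis by linarith
    qed
    have "(\<integral>\<^sup>+x. ennreal ((f x)\<^sup>2 * w x) \<partial>M) \<le> (\<integral>\<^sup>+x. ennreal (G x) \<partial>M)"
      by (rule nn_integral_mono_AE) (use w0 fh in eventually_elim, auto intro: ennreal_leI dest: le)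
    also have "\<dots> = ennreal (\<integral>x. G x \<partial>M)"
      by (rule nn_integral_eq_integral[OF G]) (use w0 fh in eventually_elim, auto dest: le)
    also have "\<dots> \<le> ennreal r"
    proof (rule ennreal_leI)
      have "(\<integral>x. G x \<partial>M) = K * (\<integral>x. \<bar>f x\<bar> * h x \<partial>M)
          + (\<integral>x. (if K < w x then (h x)\<^sup>2 * w x else 0) \<partial>M)"
        unfolding G_def using int_tail L2_integrable_mult[OF L2_abs[OF f] h] by simp
      moreover have "K * (\<integral>x. \<bar>f x\<bar> * h x \<partial>M) \<le> r/2"
        using bound K by (simp add: field_simps)
      ultimately show "(\<integral>x. G x \<partial>M) \<le> r" using tail by linarith
    qed
    finally have "(\<integral>\<^sup>+x. ennreal ((f x)\<^sup>2 * w x) \<partial>M) \<le> ennreal r" .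
    then show ?thesis by (simp add: add_increasing)
  next
    case False
    have "(\<integral>\<^sup>+x. ennreal ((f x)\<^sup>2 * w x) \<partial>M) \<le> (\<integral>\<^sup>+x. ennreal ((h x)\<^sup>2 * w x) \<partial>M)"
    proof (rule nn_integral_mono_AE, use w0 fh in eventually_elim)
      fix x assume "0 \<le> w x" "\<bar>f x\<bar> \<le> h x"
      then show "ennreal ((f x)\<^sup>2 * w x) \<le> ennreal ((h x)\<^sup>2 * w x)"
        by (metis abs_ge_zero power2_abs power_mono mult_right_mono ennreal_leI)
    qed
    also have "\<dots> = ennreal C"
      unfolding C_def by (rule nn_integral_eq_integral[OF hw]) (use w0 in auto)
    also have "\<dots> = ennreal (C / \<epsilon>) * ennreal \<epsilon>"
      using C0 \<epsilon> by (simp flip: ennreal_mult)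
    also have "\<dots> \<le> ennreal (C / \<epsilon>) * q f + ennreal r"
      using False by (intro add_increasing2 mult_left_mono) auto
    finally show ?thesis .
  qed
  then show ?thesis using C0 \<epsilon> by (intro exI[of _ "C / \<epsilon>"]) auto
qed

text \<open>Every term is homogeneous of degree 2 in \<open>f\<close>, so dividing \<open>f\<close>
  by the essential supremum \<open>t\<close> reduces to the normalised case. The values \<infinity>
  and 0 of \<open>t\<close> are treated separately: the first makes the right-hand side infinite
  since \<open>r > 0\<close>, the second makes \<open>f\<close> vanish a.e.\<close>

lemma weak_Hardy:
  fixes M :: "'a measure" and q :: "('a \<Rightarrow> real) \<Rightarrow> ennreal" and h w :: "'a \<Rightarrow> real"
  assumes q: "quadratic_form M q" and closed: "closed_form M q"
    and BD: "first_Beurling_Deny M q"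
    and kernel: "\<And>f. f \<in> L2 M \<Longrightarrow> q f = 0 \<Longrightarrow> AE x in M. f x = 0"
    and h: "h \<in> L2 M" and h0: "AE x in M. 0 < h x"
    and w: "w \<in> borel_measurable M" and w0: "AE x in M. 0 \<le> w x"
    and hw: "integrable M (\<lambda>x. (h x)\<^sup>2 * w x)"
    and r: "0 < r"
  shows "\<exists>a\<ge>0. \<forall>f\<in>L2 M. (\<integral>\<^sup>+x. ennreal ((f x)\<^sup>2 * w x) \<partial>M)
    \<le> ennreal a * q f + ennreal r * (Linf_norm M (\<lambda>x. f x / h x))\<^sup>2"
proof -
  obtain a where a: "0 \<le> a" and bound: "\<And>f. f \<in> L2 M \<Longrightarrow> AE x in M. \<bar>f x\<bar> \<le> h x \<Longrightarrow>
      (\<integral>\<^sup>+x. ennreal ((f x)\<^sup>2 * w x) \<partial>M) \<le> ennreal a * q f + ennreal r"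
    using weak_Hardy_dominated[OF q closed BD kernel h w w0 hw r] by blast
  have "(\<integral>\<^sup>+x. ennreal ((f x)\<^sup>2 * w x) \<partial>M)
      \<le> ennreal a * q f + ennreal r * (Linf_norm M (\<lambda>x. f x / h x))\<^sup>2" if f: "f \<in> L2 M" for f
  proof -
    have [measurable]: "f \<in> borel_measurable M" "h \<in> borel_measurable M" "w \<in> borel_measurable M"
      using f h w by (auto dest: L2_borel)
    have ess: "AE x in M. ennreal \<bar>f x / h x\<bar> \<le> Linf_norm M (\<lambda>x. f x / h x)"
      unfolding Linf_norm_def by (rule esssup_AE)
    show ?thesis
    proof (cases "Linf_norm M (\<lambda>x. f x / h x)")
      case top
      then show ?thesis using r by (simp add: power2_eq_square ennreal_mult_top)
    next
      case (real t)
      have ft: "AE x in M. \<bar>f x\<bar> \<le> t * h x"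
        using ess h0 unfolding real(2)
        by eventually_elim (use real(1) in \<open>simp add: abs_divide pos_divide_le_eq\<close>)
      show ?thesis
      proof (cases "t = 0")
        case True
        have "(\<integral>\<^sup>+x. ennreal ((f x)\<^sup>2 * w x) \<partial>M) = (\<integral>\<^sup>+x. 0 \<partial>M)"
          by (rule nn_integral_cong_AE) (use ft True in \<open>auto elim: eventually_mono\<close>)
        then show ?thesis by simp
      next
        case False
        then have t: "0 < t" using real(1) by simp
        \<comment> \<open>Scaling back cancels in the form term and leaves the factor
          \<open>t\<^sup>2\<close> on \<open>r\<close>.\<close>
        have t2: "ennreal (t\<^sup>2) * ennreal ((1/t)\<^sup>2) = 1"
          using t by (simp add: power_divide flip: ennreal_mult)
        have "(\<integral>\<^sup>+x. ennreal ((f x)\<^sup>2 * w x) \<partial>M)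
            = (\<integral>\<^sup>+x. ennreal (t\<^sup>2) * ennreal ((1/t * f x)\<^sup>2 * w x) \<partial>M)"
          using t by (intro nn_integral_cong) (simp add: power_divide flip: ennreal_mult')
        also have "\<dots> = ennreal (t\<^sup>2) * (\<integral>\<^sup>+x. ennreal ((1/t * f x)\<^sup>2 * w x) \<partial>M)"
          by (rule nn_integral_cmult) simp
        also have "\<dots> \<le> ennreal (t\<^sup>2) * (ennreal a * q (\<lambda>x. 1/t * f x) + ennreal r)"
          using ft t by (intro mult_left_mono bound L2_cmult[OF f]) (auto simp: abs_mult field_simps elim!: eventually_mono)
        also have "\<dots> = ennreal (t\<^sup>2) * ennreal ((1/t)\<^sup>2) * (ennreal a * q f) + ennreal r * ennreal (t\<^sup>2)"
          unfolding form_cmult[OF q f] distrib_left by (simp only: mult_ac)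
        also have "\<dots> = ennreal a * q f + ennreal r * (Linf_norm M (\<lambda>x. f x / h x))\<^sup>2"
          using real by (simp only: t2 ennreal_power mult_1)
        finally show ?thesis .
      qed
    qed
  qed
  then show ?thesis using a by blast
qed

section \<open>The decreasing rate function\<close>

theorem theorem4p3:
  fixes M :: "'a measure" and q :: "('a \<Rightarrow> real) \<Rightarrow> ennreal" and h w :: "'a \<Rightarrow> real"
  assumes "sigma_finite_measure M"
    and "quadratic_form M q"
    and "densely_defined M q"
    and "closed_form M q"
    and "first_Beurling_Deny M q"
    and "form_kernel M q = {f \<in> L2 M. AE x in M. f x = 0}"
    and "h \<in> L2 M" and "AE x in M. 0 < h x"
    and "w \<in> L2 M" and "AE x in M. 0 \<le> w x"
    and "integrable (density M (\<lambda>x. ennreal ((h x)\<^sup>2))) w"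
  shows "\<exists>\<alpha> :: real \<Rightarrow> real.
           (\<forall>r>0. 0 < \<alpha> r) \<and> antimono_on {0<..} \<alpha> \<and>
           (\<forall>r>0. \<forall>f\<in>form_domain M q.
              (\<integral>\<^sup>+x. ennreal (\<bar>f x\<bar>\<^sup>2 * w x) \<partial>M)
                \<le> ennreal (\<alpha> r) * q f + ennreal r * (Linf_norm M (\<lambda>x. f x / h x))\<^sup>2)"
proof -
  \<comment> \<open>Picking one constant for each \<open>r\<close> would give no monotonicity. The
    infimum over all admissible constants does, because raising \<open>r\<close> weakens the
    inequality and so enlarges \<open>A r\<close>.\<close>
  define A where "A r = {a. 0 \<le> a \<and> (\<forall>f\<in>L2 M. (\<integral>\<^sup>+x. ennreal ((f x)\<^sup>2 * w x) \<partial>M)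
    \<le> ennreal a * q f + ennreal r * (Linf_norm M (\<lambda>x. f x / h x))\<^sup>2)}" for r
  have hw: "integrable M (\<lambda>x. (h x)\<^sup>2 * w x)"
    using assms(11) L2_borel[OF assms(7)] L2_borel[OF assms(9)]
    by (simp add: integrable_real_density)
  have kernel: "AE x in M. f x = 0" if "f \<in> L2 M" "q f = 0" for f
    using assms(6) that by (auto simp: form_kernel_def)
  have nonempty: "A r \<noteq> {}" if "0 < r" for r
    using weak_Hardy[OF assms(2,4,5) kernel assms(7,8) L2_borel[OF assms(9)] assms(10) hw that]
    by (auto simp: A_def)
  have bdd: "bdd_below (A r)" for r by (rule bdd_belowI[of _ 0]) (simp add: A_def)
  have A_mono: "A r \<subseteq> A s" if "r \<le> s" for r s
  proof -
    have "ennreal r * c \<le> ennreal s * c" for c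
      using that by (intro mult_right_mono ennreal_leI) auto
    then show ?thesis unfolding A_def by (blast intro: order_trans add_left_mono)
  qed
  \<comment> \<open>Adding \<open>1\<close> makes \<open>\<alpha>\<close> positive and spares showing that the infimum is attained.\<close>
  define \<alpha> where "\<alpha> r = Inf (A r) + 1" for r
  have "0 < \<alpha> r" if "0 < r" for r
  proof -
    have "0 \<le> Inf (A r)" using nonempty[OF that] by (intro cInf_greatest) (auto simp: A_def)
    then show ?thesis by (simp add: \<alpha>_def)
  qed
  moreover have "antimono_on {0<..} \<alpha>"
    by (rule monotone_onI) (auto simp: \<alpha>_def intro!: cInf_superset_mono nonempty bdd A_mono)
  moreover have "(\<integral>\<^sup>+x. ennreal (\<bar>f x\<bar>\<^sup>2 * w x) \<partial>M)
      \<le> ennreal (\<alpha> r) * q f + ennreal r * (Linf_norm M (\<lambda>x. f x / h x))\<^sup>2"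
    if r: "0 < r" and f: "f \<in> form_domain M q" for r f
  proof -
    obtain a where a: "a \<in> A r" "a < \<alpha> r"
      using cInf_lessD[OF nonempty[OF r], of "\<alpha> r"] by (auto simp: \<alpha>_def)
    have "(\<integral>\<^sup>+x. ennreal (\<bar>f x\<bar>\<^sup>2 * w x) \<partial>M)
        \<le> ennreal a * q f + ennreal r * (Linf_norm M (\<lambda>x. f x / h x))\<^sup>2"
      using a(1) f by (simp add: A_def form_domain_def)
    also have "\<dots> \<le> ennreal (\<alpha> r) * q f + ennreal r * (Linf_norm M (\<lambda>x. f x / h x))\<^sup>2"
      using a(2) by (intro add_right_mono mult_right_mono ennreal_leI) auto
    finally show ?thesis .
  qed
  ultimately show ?thesis by blast
qed

end
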